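(* Let $n,k,m,r$ be positive integers with $r<k\le m$ and $n\geq \left\lfloor\frac{k-1}{r}\right\rfloor{m\choose k-1}$. Let $\mathcal B=\{B_1,\dots,B_n\}$ be a family of subsets of $[m]$ in which the first $\left\lfloor\frac{k-1}{r}\right\rfloor{m\choose k-1}$ blocks consist of exactly $\left\lfloor\frac{k-1}{r}\right\rfloor$ copies of each $(k-1)$-subset of $[m]$, and each remaining block is an arbitrary $k$-subset of $[m]$. For $j\in[m]$ let $C_j=\{i\in[n]: j\in B_i\}$. Then $\{C_1,\dots,C_m\}$ is an $(n,N,k,m;r)$-MCBC with $N=kn-\left\lfloor\frac{k-1}{r}\right\rfloor{m\choose k-1}$.
   Context: An $(n,N,k,m;r)$ multiset combinatorial batch code (MCBC) is a collection $\mathcal C=\{C_1,\dots,C_m\}$ of subsets of $[n]=\{1,\dots,n\}$ (servers) with $N=\sum_{j=1}^m|C_j|$, such that for every multiset request $\{i_1,\dots,i_k\}$ of $k$ elements of $[n]$ in which every element has multiplicity at most $r$, there exist subsets $D_j\subseteq C_j$ with $|D_j|\le 1$ ($j\in[m]$) whose multiset union (the multiplicity of $i$ being $|\{j: i\in D_j\}|$) contains the request. *)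

theory Defs
  imports Main "HOL-Library.Multiset"
begin

(* C is an indexed family of subsets of {1..n}, indexed by {1..m}; the sets need not be distinct.
   A request is a multiset over {1..n}.  The multiplicity of i in the sum of the mset_set (D j)
   is the number of j in {1..m} with i in D j, because every D j is finite, being a subset of C j. *)
definition is_mcbc ::
  "nat \<Rightarrow> nat \<Rightarrow> nat \<Rightarrow> nat \<Rightarrow> nat \<Rightarrow> (nat \<Rightarrow> nat set) \<Rightarrow> bool" where
  "is_mcbc n N k m r C \<longleftrightarrow>
     (\<forall>j\<in>{1..m}. C j \<subseteq> {1..n}) \<and>
     N = (\<Sum>j\<in>{1..m}. card (C j)) \<and>
     (\<forall>R :: nat multiset.
        set_mset R \<subseteq> {1..n} \<and> size R = k \<and> (\<forall>i. count R i \<le> r) \<longrightarrow>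
        (\<exists>D :: nat \<Rightarrow> nat set.
           (\<forall>j\<in>{1..m}. D j \<subseteq> C j \<and> card (D j) \<le> 1) \<and>
           R \<subseteq># (\<Sum>j\<in>{1..m}. mset_set (D j))))"

end

theory Submission
  imports Defs
begin

text \<open>
  Servers are assigned greedily: an item stored on more servers than have been used so far can
  always be served. As every block has at least \<open>k - 1\<close> elements, only the last of the \<open>k\<close> requests
  may fail, and it succeeds if its block has \<open>k\<close> elements. If all requested blocks are
  \<open>(k - 1)\<close>-sets, they cannot all be equal, since only \<open>\<lfloor>(k - 1) / r\<rfloor>\<close> items share a block and each
  is requested at most \<open>r\<close> times. So there are requested items \<open>a\<close>, \<open>b\<close> and a server \<open>x\<close> that stores
  \<open>a\<close> but not \<open>b\<close>. Serving \<open>a\<close> from \<open>x\<close> first and \<open>b\<close> last, at most \<open>k - 2\<close> of the servers that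
  store \<open>b\<close> are occupied at the end.
\<close>

text \<open>\<open>X\<close> is the set of occupied servers and \<open>f\<close> names the one item
  that each of them delivers. As \<open>f\<close> is a function, no server is used twice, while
  repeated requests for an item simply have several preimages.\<close>

definition serves :: "('a \<Rightarrow> 'b set) \<Rightarrow> 'b set \<Rightarrow> ('b \<Rightarrow> 'a) \<Rightarrow> 'a multiset \<Rightarrow> bool" where
  "serves B X f R \<longleftrightarrow> finite X \<and> image_mset f (mset_set X) = R \<and> (\<forall>x\<in>X. x \<in> B (f x))"

lemma card_eq_size_if_serves: "serves B X f R \<Longrightarrow> card X = size R"
  unfolding serves_def by (metis size_image_mset size_mset_set)

lemma serves_empty: "serves B {} f {#}"
  by (simp add: serves_def)

lemma serves_insert:
  assumes "serves B X f R" and "x \<notin> X" and "x \<in> B i"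
  shows "serves B (insert x X) (f(x := i)) (add_mset i R)"
proof -
  have "image_mset (f(x := i)) (mset_set X) = image_mset f (mset_set X)"
    using assms by (intro image_mset_cong) (auto simp: serves_def)
  then show ?thesis
    using assms by (auto simp: serves_def)
qed

text \<open>When the last item of \<open>S\<close> is added, fewer servers are occupied than its
  block contains, so one is free. Earlier assignments are extended, never revised;
  \<open>X \<subseteq> Y\<close> records that servers reserved beforehand stay occupied.\<close>

lemma serves_greedy:
  assumes "serves B X f R" and "\<And>i. i \<in># S \<Longrightarrow> size R + size S \<le> card (B i)"
  shows "\<exists>Y g. X \<subseteq> Y \<and> serves B Y g (R + S)"
  using assms(2)
proof (induction S)
  case empty
  then show ?case using assms(1) by auto
next
  case (add i S)
  have "size R + size S \<le> card (B j)" if "j \<in># S" for j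
    using add.prems[of j] that by simp
  then obtain Y g where Y: "X \<subseteq> Y" "serves B Y g (R + S)"
    using add.IH by blast
  have "card Y < card (B i)"
    using add.prems[of i] card_eq_size_if_serves[OF Y(2)] by simp
  then have "\<not> B i \<subseteq> Y"
    using Y(2) card_mono by (metis leD serves_def)
  then obtain y where "y \<in> B i" "y \<notin> Y" by blast
  from serves_insert[OF Y(2) this(2,1)] Y(1) show ?case
    by (metis subset_insertI2 union_mset_add_mset_right)
qed

text \<open>One copy of \<open>i\<close> is kept for last: the other \<open>size R - 1\<close>
  requests fit greedily, and the larger block of \<open>i\<close> still has a free server.\<close>

lemma serves_if_large_block:
  assumes "i \<in># R" and "size R \<le> card (B i)" and "\<And>j. j \<in># R \<Longrightarrow> size R - 1 \<le> card (B j)"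
  shows "\<exists>X f. serves B X f R"
proof -
  obtain S where R: "R = add_mset i S"
    using assms(1) by (metis insert_DiffM)
  have "size {#} + size S \<le> card (B j)" if "j \<in># S" for j
    using assms(3)[of j] that R by simp
  then obtain X f where X: "serves B X f S"
    using serves_greedy[OF serves_empty, of S B] by auto
  have "size S + size {#i#} \<le> card (B j)" if "j \<in># {#i#}" for j
    using assms(2) that R by simp
  from serves_greedy[OF X this] show ?thesis
    by (auto simp: R)
qed

lemma serves_if_different_blocks:
  assumes "a \<in># R" and "b \<in># R" and "x \<in> B a" and "x \<notin> B b"
    and "\<And>j. j \<in># R \<Longrightarrow> size R - 1 \<le> card (B j)"
  shows "\<exists>X f. serves B X f R"
proof -
  have "a \<noteq> b" using assms(3,4) by blast
  then obtain S where R: "R = add_mset b (add_mset a S)"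
    using assms(1,2) by (metis insert_noteq_member insert_DiffM)
  have "size {#a#} + size S \<le> card (B j)" if "j \<in># S" for j
    using assms(5)[of j] that R by simp
  then obtain X f where X: "x \<in> X" "serves B X f (add_mset a S)"
    using serves_greedy[OF serves_insert[where x = x and i = a, OF serves_empty[where f = undefined]], of B S]
      assms(3) by auto
  \<comment> \<open>As \<open>x\<close> lies outside \<open>B b\<close>, only the
    \<open>size R - 2\<close> servers in \<open>X - {x}\<close> can obstruct
    \<open>b\<close>.\<close>
  have "card (X - {x}) < card (B b)" "finite X"
    using assms(5)[of b] X card_eq_size_if_serves[OF X(2)] R by (auto simp: serves_def)
  then have "\<not> B b \<subseteq> X - {x}"
    by (meson card_mono finite_Diff leD)
  then obtain y where "y \<in> B b" "y \<notin> X"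
    using assms(4) by blast
  from serves_insert[OF X(2) this(2,1)] show ?thesis
    unfolding R by blast
qed

lemma size_le_if_count_le:
  assumes "set_mset R \<subseteq> A" and "finite A" and "\<And>i. count R i \<le> r"
  shows "size R \<le> r * card A"
proof -
  have "size R = (\<Sum>i\<in>A. count R i)"
    using assms(1,2) by (simp add: size_multiset_overloaded_eq)
      (intro sum.mono_neutral_left, auto simp: not_in_iff)
  also have "\<dots> \<le> (\<Sum>i\<in>A. r)"
    by (intro sum_mono assms(3))
  finally show ?thesis by (simp add: mult.commute)
qed

text \<open>Passes from items to servers: \<open>N\<close> is found by double counting the
  incidences, and an assignment \<open>f\<close> on \<open>X\<close> turns into the singletons
  \<open>{f j}\<close> for \<open>j \<in> X\<close>.\<close>

lemma is_mcbc_dual: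
  fixes B :: "nat \<Rightarrow> nat set"
  assumes B: "\<And>i. i \<in> {1..n} \<Longrightarrow> B i \<subseteq> {1..m}"
    and N: "N = (\<Sum>i\<in>{1..n}. card (B i))"
    and serves: "\<And>R. \<lbrakk>set_mset R \<subseteq> {1..n}; size R = k; \<And>i. count R i \<le> r\<rbrakk>
      \<Longrightarrow> \<exists>X f. serves B X f R"
  shows "is_mcbc n N k m r (\<lambda>j. {i \<in> {1..n}. j \<in> B i})"
  unfolding is_mcbc_def
proof (intro conjI allI impI)
  show "\<forall>j\<in>{1..m}. {i \<in> {1..n}. j \<in> B i} \<subseteq> {1..n}" by auto
  have "(\<Sum>j\<in>{1..m}. card {i \<in> {1..n}. j \<in> B i}) = (\<Sum>i\<in>{1..n}. card {j \<in> {1..m}. j \<in> B i})"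
    by (rule sum_multicount_gen[symmetric]) auto
  also have "\<dots> = N"
    unfolding N using B by (intro sum.cong refl arg_cong[where f = card]) blast
  finally show "N = (\<Sum>j\<in>{1..m}. card {i \<in> {1..n}. j \<in> B i})" by simp
next
  fix R :: "nat multiset"
  assume R: "set_mset R \<subseteq> {1..n} \<and> size R = k \<and> (\<forall>i. count R i \<le> r)"
  then obtain X f where X: "serves B X f R" using serves[of R] by auto
  have fin: "finite X" and im: "image_mset f (mset_set X) = R" and mem: "\<And>x. x \<in> X \<Longrightarrow> x \<in> B (f x)"
    using X by (auto simp: serves_def)
  have f: "f x \<in> {1..n}" if "x \<in> X" for x
    using that R fin unfolding im[symmetric] by (simp add: image_subset_iff)
  have sub: "X \<subseteq> {1..m}"
    using mem f B by blast
  define D where "D j = (if j \<in> X then {f j} else {})" for j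
  have "(\<Sum>j\<in>{1..m}. mset_set (D j)) = (\<Sum>j\<in>X. mset_set (D j))"
    using sub by (intro sum.mono_neutral_right) (auto simp: D_def)
  also have "\<dots> = (\<Sum>j\<in>X. {#f j#})"
    by (intro sum.cong) (auto simp: D_def)
  also have "\<dots> = R"
    unfolding im[symmetric] using fin by (induction X rule: finite_induct) auto
  finally show "\<exists>D. (\<forall>j\<in>{1..m}. D j \<subseteq> {i \<in> {1..n}. j \<in> B i} \<and> card (D j) \<le> 1) \<and>
           R \<subseteq># (\<Sum>j\<in>{1..m}. mset_set (D j))"
    using f mem by (intro exI[of _ D]) (auto simp: D_def)
qed

theorem theorem8:
  fixes n k m r :: nat and B :: "nat \<Rightarrow> nat set"
  assumes "0 < n" and "0 < k" and "0 < m" and "0 < r"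
    and "r < k" and "k \<le> m"
    and "((k - 1) div r) * (m choose (k - 1)) \<le> n"
    and "image_mset B (mset_set {1..((k - 1) div r) * (m choose (k - 1))}) =
           repeat_mset ((k - 1) div r) (mset_set {S. S \<subseteq> {1..m} \<and> card S = k - 1})"
    and "\<forall>i\<in>{((k - 1) div r) * (m choose (k - 1)) + 1..n}. B i \<subseteq> {1..m} \<and> card (B i) = k"
  shows "is_mcbc n (k * n - ((k - 1) div r) * (m choose (k - 1))) k m r
           (\<lambda>j. {i \<in> {1..n}. j \<in> B i})"
proof -
  define q where "q = (k - 1) div r"
  define T where "T = q * (m choose (k - 1))"
  define P where "P = {S. S \<subseteq> {1..m} \<and> card S = k - 1}"
  have T: "T \<le> n" and imB: "image_mset B (mset_set {1..T}) = repeat_mset q (mset_set P)"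
    and late: "\<And>i. i \<in> {T + 1..n} \<Longrightarrow> B i \<subseteq> {1..m} \<and> card (B i) = k"
    using assms(7-9) by (simp_all add: T_def q_def P_def)
  have "finite P" by (simp add: P_def)
  have early: "B i \<in> P" if "i \<in> {1..T}" for i
  proof -
    have "B i \<in># image_mset B (mset_set {1..T})" using that by simp
    then have "B i \<in># mset_set P"
      unfolding imB count_greater_zero_iff[symmetric] count_repeat_mset by simp
    then show ?thesis using \<open>finite P\<close> by simp
  qed
  \<comment> \<open>\<open>mset_set P\<close> has multiplicities at most 1, so repeating it
    \<open>q\<close> times gives at most \<open>q\<close>.\<close>
  have copies: "card {i \<in> {1..T}. B i = S} \<le> q" for S
  proof -
    have "card {i \<in> {1..T}. B i = S} = count (image_mset B (mset_set {1..T})) S"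
      by (simp add: count_conv_size_mset filter_mset_image_mset)
    also have "\<dots> \<le> q"
      unfolding imB by (simp add: count_mset_set')
    finally show ?thesis .
  qed
  have block: "B i \<subseteq> {1..m} \<and> (i \<le> T \<and> card (B i) = k - 1 \<or> card (B i) = k)"
    if "i \<in> {1..n}" for i
    using early[of i] late[of i] that by (cases "i \<le> T") (auto simp: P_def)
  have "(\<Sum>i\<in>{1..n}. card (B i)) = (\<Sum>i\<in>{1..T}. card (B i)) + (\<Sum>i\<in>{T + 1..n}. card (B i))"
    using T by (subst sum.union_disjoint[symmetric]) (auto intro!: sum.cong)
  also have "\<dots> = T * (k - 1) + (n - T) * k"
    using early late by (simp add: P_def)
  also have "\<dots> = k * n - T"
  proof -
    \<comment> \<open>These substitutions eliminate the truncated subtractions.\<close>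
    obtain d where "n = T + d" using T le_Suc_ex by blast
    moreover obtain l where "k = Suc l" using \<open>0 < k\<close> gr0_conv_Suc by blast
    ultimately show ?thesis by (simp add: algebra_simps)
  qed
  finally have N: "k * n - T = (\<Sum>i\<in>{1..n}. card (B i))" by simp
  have "\<exists>X f. serves B X f R"
    if R: "set_mset R \<subseteq> {1..n}" "size R = k" "\<And>i. count R i \<le> r" for R
  proof (cases "\<exists>i\<in>#R. card (B i) = k")
    case True
    have "size R - 1 \<le> card (B j)" if "j \<in># R" for j
      using block[of j] R that by fastforce
    with True R(2) serves_if_large_block[of _ R B] show ?thesis by auto
  next
    case False
    then have small: "j \<in> {1..T}" "card (B j) = k - 1" "finite (B j)" if "j \<in># R" for j
      using block[of j] R(1) that finite_subset[of "B j" "{1..m}"] by auto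
    obtain a where a: "a \<in># R" using R(2) \<open>0 < k\<close> by fastforce
    have "\<exists>b\<in>#R. B b \<noteq> B a"
    proof (rule ccontr)
      assume "\<not> ?thesis"
      then have "set_mset R \<subseteq> {i \<in> {1..T}. B i = B a}"
        using small(1) by blast
      then have "k \<le> r * card {i \<in> {1..T}. B i = B a}"
        using size_le_if_count_le[of R, OF _ _ R(3)] R(2) by simp
      also have "\<dots> \<le> r * q" using copies by simp
      also have "\<dots> \<le> k - 1" by (simp add: q_def)
      finally show False using \<open>0 < k\<close> by simp
    qed
    then obtain b where b: "b \<in># R" "B b \<noteq> B a" by blast
    \<comment> \<open>Both blocks are finite of size \<open>k - 1\<close>, so inclusion would force
      equality.\<close>
    then have "\<not> B a \<subseteq> B b"
      using small a by (metis card_subset_eq)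
    then obtain x where "x \<in> B a" "x \<notin> B b" by blast
    with a b small(2) R(2) show ?thesis
      by (intro serves_if_different_blocks[of a R b x B]) auto
  qed
  with is_mcbc_dual[OF _ N] block show ?thesis
    by (simp add: T_def q_def)
qed

end
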